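(* Let $n\ge 1$ and let $p=(p_1,\dots,p_n)$, $q=(q_1,\dots,q_n)$ be real vectors of variables. Let $P,Q$ be the real cyclic Hankel $n\times n$ matrices defined by $P_{ij}=p_{k(i,j)}$, $Q_{ij}=q_{k(i,j)}$, where $k(i,j)=((i+j-2)\bmod n)+1$ (so the first row is indexed $1,2,\dots,n$, the second row $2,3,\dots,n,1$, etc.). Then the Böttcher–Wenzel form \[ BW=2\Big(\|P\|^2\|Q\|^2-\mathrm{trace}^2(P^TQ)\Big)-\|PQ-QP\|^2 \] (Frobenius norm) is a sum of squares of real polynomials in the variables $p_1,\dots,p_n,q_1,\dots,q_n$.
   Context: A polynomial is a sum of squares (sos) if it is a finite sum of squares of real polynomials. *)

theory Defs
  imports
    Complex_Main
    "HOL-Library.Poly_Mapping"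
    "Jordan_Normal_Form.Matrix"
begin

datatype bw_var = PVar nat | QVar nat

text \<open>Real multivariate polynomials: finitely supported maps from monomials (finitely supported
  exponent vectors) to coefficients, with the convolution product of \<open>Poly_Mapping\<close>.\<close>

type_synonym 'v rpoly = "('v \<Rightarrow>\<^sub>0 nat) \<Rightarrow>\<^sub>0 real"

definition Var :: "'v \<Rightarrow> 'v rpoly" where
  "Var x = Poly_Mapping.single (Poly_Mapping.single x 1) 1"

definition polys_in :: "'v set \<Rightarrow> 'v rpoly set" where
  "polys_in V = {f. \<forall>m \<in> Poly_Mapping.keys f. Poly_Mapping.keys m \<subseteq> V}"

definition sos_in :: "'v set \<Rightarrow> 'v rpoly \<Rightarrow> bool" where
  "sos_in V f \<longleftrightarrow> (\<exists>gs. set gs \<subseteq> polys_in V \<and> f = (\<Sum>g\<leftarrow>gs. g\<^sup>2))"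

definition bw_vars :: "nat \<Rightarrow> bw_var set" where
  "bw_vars n = PVar ` {1..n} \<union> QVar ` {1..n}"

definition cyclic_index :: "nat \<Rightarrow> nat \<Rightarrow> nat \<Rightarrow> nat" where
  "cyclic_index n i j = ((i + j - 2) mod n) + 1"

text \<open>Matrix entries are addressed from 0, whereas the index \<open>k(i,j)\<close> is given for
  \<open>1 \<le> i, j \<le> n\<close>; hence the shift.\<close>

definition cyclic_hankel :: "nat \<Rightarrow> (nat \<Rightarrow> 'a) \<Rightarrow> 'a mat" where
  "cyclic_hankel n v = mat n n (\<lambda>(i, j). v (cyclic_index n (i + 1) (j + 1)))"

definition mat_trace :: "'a::comm_monoid_add mat \<Rightarrow> 'a" where
  "mat_trace A = (\<Sum>i<dim_row A. A $$ (i, i))"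

text \<open>The square of the Frobenius norm, over any commutative ring, so that it makes sense for
  matrices of polynomials.\<close>

definition frobenius_sq :: "'a::comm_ring_1 mat \<Rightarrow> 'a" where
  "frobenius_sq A = (\<Sum>i<dim_row A. \<Sum>j<dim_col A. (A $$ (i, j))\<^sup>2)"

definition BW :: "'a::comm_ring_1 mat \<Rightarrow> 'a mat \<Rightarrow> 'a" where
  "BW P Q = 2 * (frobenius_sq P * frobenius_sq Q - (mat_trace (transpose_mat P * Q))\<^sup>2)
            - frobenius_sq (P * Q - Q * P)"

end

theory Submission
  imports Defs "HOL-Number_Theory.Cong"
begin

text \<open>Write \<open>w\<^sub>a\<^sub>b = p\<^sub>a q\<^sub>b - q\<^sub>a p\<^sub>b\<close> with indices modulo \<open>n\<close>. Then the \<open>(i, j)\<close> entry of the commutator is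
  \<open>\<Sum>\<^sub>k x\<^sub>k\<close> with \<open>x\<^sub>k = w\<^sub>i\<^sub>+\<^sub>k\<^sub>,\<^sub>k\<^sub>+\<^sub>j\<close>, while by Lagrange's identity the first term of the form is
  \<open>n\<^sup>2 \<Sum>\<^sub>a\<^sub>b w\<^sub>a\<^sub>b\<^sup>2\<close>, which by cyclic invariance is \<open>\<Sum>\<^sub>i\<^sub>j n \<Sum>\<^sub>k x\<^sub>k\<^sup>2\<close>. So the form is the sum over
  \<open>i, j\<close> of the Cauchy--Schwarz defects \<open>n \<Sum>\<^sub>k x\<^sub>k\<^sup>2 - (\<Sum>\<^sub>k x\<^sub>k)\<^sup>2 = \<Sum>\<^sub>k\<^sub>l (x\<^sub>k - x\<^sub>l)\<^sup>2 / 2\<close>.\<close>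

text \<open>Rotation modulo \<open>n\<close> is an injective self-map of a finite set, hence a
  permutation, and the sum is merely reindexed.\<close>

lemma sum_cyclic_shift:
  fixes g :: "nat \<Rightarrow> 'a::comm_monoid_add"
  assumes "n > 0"
  shows "(\<Sum>k<n. g ((k + i) mod n)) = (\<Sum>k<n. g k)"
proof -
  have inj: "inj_on (\<lambda>k. (k + i) mod n) {..<n}"
  proof (rule inj_onI)
    fix x y assume "x \<in> {..<n}" "y \<in> {..<n}" "(x + i) mod n = (y + i) mod n"
    then show "x = y"
      by (metis cong_add_rcancel_nat cong_def lessThan_iff mod_less)
  qed
  have "(\<lambda>k. (k + i) mod n) ` {..<n} = {..<n}"
    using assms by (intro endo_inj_surj inj) auto
  then show ?thesis
    using sum.reindex[OF inj, of g] by simp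
qed

lemma sum_cyclic_shift':
  fixes g :: "nat \<Rightarrow> 'a::comm_monoid_add"
  assumes "n > 0"
  shows "(\<Sum>k<n. g ((i + k) mod n)) = (\<Sum>k<n. g k)"
  using sum_cyclic_shift[OF assms, of g i] by (simp add: add.commute)

text \<open>Expanding the squares suffices. Ordered pairs count each difference twice, and keeping
  the factor 2 avoids division in the ring.\<close>

lemma sum_diff_squares:
  fixes x :: "'b \<Rightarrow> 'a::comm_ring_1"
  shows "(\<Sum>k\<in>A. \<Sum>l\<in>A. (x k - x l)\<^sup>2)
    = 2 * (of_nat (card A) * (\<Sum>k\<in>A. (x k)\<^sup>2) - (\<Sum>k\<in>A. x k)\<^sup>2)"
proof -
  have "(\<Sum>k\<in>A. \<Sum>l\<in>A. (x k - x l)\<^sup>2)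
      = (\<Sum>k\<in>A. \<Sum>l\<in>A. (x k)\<^sup>2 + (x l)\<^sup>2 - 2 * (x k * x l))"
    by (simp add: power2_diff mult.assoc)
  also have "\<dots> = 2 * (of_nat (card A) * (\<Sum>k\<in>A. (x k)\<^sup>2)) - 2 * (\<Sum>k\<in>A. \<Sum>l\<in>A. x k * x l)"
    by (simp add: sum.distrib sum_subtractf flip: sum_distrib_left)
  also have "(\<Sum>k\<in>A. \<Sum>l\<in>A. x k * x l) = (\<Sum>k\<in>A. x k)\<^sup>2"
    by (simp add: power2_eq_square sum_product)
  finally show ?thesis by (simp add: algebra_simps)
qed

lemma lagrange_identity:
  fixes p q :: "'b \<Rightarrow> 'a::comm_ring_1"
  shows "(\<Sum>a\<in>A. \<Sum>b\<in>A. (p a * q b - q a * p b)\<^sup>2)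
    = 2 * ((\<Sum>a\<in>A. (p a)\<^sup>2) * (\<Sum>a\<in>A. (q a)\<^sup>2) - (\<Sum>a\<in>A. p a * q a)\<^sup>2)"
proof -
  have "(\<Sum>a\<in>A. \<Sum>b\<in>A. (p a * q b - q a * p b)\<^sup>2)
      = (\<Sum>a\<in>A. \<Sum>b\<in>A. (p a)\<^sup>2 * (q b)\<^sup>2 + (q a)\<^sup>2 * (p b)\<^sup>2 - 2 * ((p a * q a) * (p b * q b)))"
    by (simp add: power2_eq_square algebra_simps)
  also have "\<dots> = (\<Sum>a\<in>A. (p a)\<^sup>2) * (\<Sum>b\<in>A. (q b)\<^sup>2) + (\<Sum>a\<in>A. (q a)\<^sup>2) * (\<Sum>b\<in>A. (p b)\<^sup>2)
      - 2 * ((\<Sum>a\<in>A. p a * q a) * (\<Sum>b\<in>A. p b * q b))"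
    unfolding sum_product by (simp only: sum.distrib sum_subtractf sum_distrib_left)
  finally show ?thesis by (simp add: power2_eq_square algebra_simps)
qed

lemma cyclic_hankel_index:
  assumes "i < n" "j < n"
  shows "cyclic_hankel n v $$ (i, j) = v ((i + j) mod n + 1)"
  using assms by (simp add: cyclic_hankel_def cyclic_index_def)

lemma dim_cyclic_hankel [simp]:
  "dim_row (cyclic_hankel n v) = n" "dim_col (cyclic_hankel n v) = n"
  by (simp_all add: cyclic_hankel_def)

text \<open>Each row is a rotation of \<open>v\<close>, so all \<open>n\<close> rows contribute
  equally.\<close>

lemma frobenius_sq_cyclic_hankel:
  assumes "n > 0"
  shows "frobenius_sq (cyclic_hankel n v) = of_nat n * (\<Sum>a<n. (v (a + 1))\<^sup>2)"
  using sum_cyclic_shift'[OF assms, of "\<lambda>a. (v (a + 1))\<^sup>2"]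
  by (simp add: frobenius_sq_def cyclic_hankel_index)

text \<open>A diagonal entry pairs equally numbered columns of the two matrices, which are rotated
  by the same amount.\<close>

lemma trace_transpose_mult_cyclic_hankel:
  fixes u v :: "nat \<Rightarrow> 'a::comm_ring_1"
  assumes "n > 0"
  shows "mat_trace (transpose_mat (cyclic_hankel n u) * cyclic_hankel n v)
    = of_nat n * (\<Sum>a<n. u (a + 1) * v (a + 1))"
  using sum_cyclic_shift[OF assms, of "\<lambda>a. u (a + 1) * v (a + 1)"]
  by (simp add: mat_trace_def scalar_prod_def cyclic_hankel_index atLeast0LessThan)

text \<open>The 2 x 2 minor of the matrix with rows \<open>u\<close> and \<open>v\<close> in the
  columns \<open>i + k\<close> and \<open>k + j\<close> modulo \<open>n\<close>.\<close>

definition hankel_minor :: "nat \<Rightarrow> (nat \<Rightarrow> 'a::comm_ring_1) \<Rightarrow> (nat \<Rightarrow> 'a) \<Rightarrow> nat \<Rightarrow> nat \<Rightarrow> nat \<Rightarrow> 'a" where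
  "hankel_minor n u v i j k =
     u ((i + k) mod n + 1) * v ((k + j) mod n + 1) - v ((i + k) mod n + 1) * u ((k + j) mod n + 1)"

lemma frobenius_sq_commutator_cyclic_hankel:
  fixes u v :: "nat \<Rightarrow> 'a::comm_ring_1"
  shows "frobenius_sq (cyclic_hankel n u * cyclic_hankel n v - cyclic_hankel n v * cyclic_hankel n u)
    = (\<Sum>i<n. \<Sum>j<n. (\<Sum>k<n. hankel_minor n u v i j k)\<^sup>2)"
  by (simp add: frobenius_sq_def scalar_prod_def cyclic_hankel_index atLeast0LessThan
      hankel_minor_def sum_subtractf)

text \<open>For fixed \<open>k\<close>, the map from \<open>(i, j)\<close> to
  \<open>(i + k, k + j)\<close> permutes the pairs modulo \<open>n\<close>, so every
  \<open>k\<close> yields the same double sum.\<close>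

lemma sum_hankel_minor_squares:
  fixes u v :: "nat \<Rightarrow> 'a::comm_ring_1"
  assumes "n > 0"
  shows "(\<Sum>i<n. \<Sum>j<n. \<Sum>k<n. (hankel_minor n u v i j k)\<^sup>2)
    = of_nat n * (\<Sum>a<n. \<Sum>b<n. (u (a + 1) * v (b + 1) - v (a + 1) * u (b + 1))\<^sup>2)"
proof -
  define w where "w a b = (u (a + 1) * v (b + 1) - v (a + 1) * u (b + 1))\<^sup>2" for a b
  have "(\<Sum>i<n. \<Sum>j<n. \<Sum>k<n. (hankel_minor n u v i j k)\<^sup>2)
      = (\<Sum>i<n. \<Sum>k<n. \<Sum>j<n. w ((i + k) mod n) ((k + j) mod n))"
    unfolding hankel_minor_def w_def by (intro sum.cong refl sum.swap)
  also have "\<dots> = (\<Sum>k<n. \<Sum>i<n. \<Sum>j<n. w ((i + k) mod n) j)"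
    by (subst sum.swap) (simp only: sum_cyclic_shift'[OF assms])
  also have "\<dots> = (\<Sum>k<n. \<Sum>i<n. \<Sum>j<n. w i j)"
    by (simp only: sum_cyclic_shift[OF assms, of "\<lambda>a. \<Sum>j<n. w a j"])
  finally show ?thesis by (simp add: w_def)
qed

lemma BW_cyclic_hankel:
  fixes u v :: "nat \<Rightarrow> 'a::comm_ring_1"
  assumes "n > 0"
  shows "2 * BW (cyclic_hankel n u) (cyclic_hankel n v)
    = (\<Sum>i<n. \<Sum>j<n. \<Sum>k<n. \<Sum>l<n. (hankel_minor n u v i j k - hankel_minor n u v i j l)\<^sup>2)"
proof -
  define S where "S = (\<Sum>a<n. \<Sum>b<n. (u (a + 1) * v (b + 1) - v (a + 1) * u (b + 1))\<^sup>2)"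
  define T where "T = (\<Sum>i<n. \<Sum>j<n. (\<Sum>k<n. hankel_minor n u v i j k)\<^sup>2)"
  have "BW (cyclic_hankel n u) (cyclic_hankel n v) = of_nat n * (of_nat n * S) - T"
    unfolding BW_def frobenius_sq_commutator_cyclic_hankel frobenius_sq_cyclic_hankel[OF assms]
      trace_transpose_mult_cyclic_hankel[OF assms] S_def lagrange_identity T_def
    by (simp add: power2_eq_square algebra_simps)
  \<comment> \<open>One factor \<open>n\<close> is absorbed here; the other serves as the
    cardinality in \<open>sum_diff_squares\<close>.\<close>
  also have "of_nat n * S = (\<Sum>i<n. \<Sum>j<n. \<Sum>k<n. (hankel_minor n u v i j k)\<^sup>2)"
    unfolding S_def sum_hankel_minor_squares[OF assms] ..
  finally show ?thesis
    unfolding T_def sum_diff_squares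
    by (simp only: card_lessThan sum_subtractf flip: sum_distrib_left)
qed

lemma Var_in_polys_in: "x \<in> V \<Longrightarrow> Var x \<in> polys_in V"
  by (simp add: Var_def polys_in_def)

lemma single_0_in_polys_in: "Poly_Mapping.single 0 c \<in> polys_in V"
  by (simp add: polys_in_def)

lemma diff_in_polys_in:
  assumes "f \<in> polys_in V" "g \<in> polys_in V"
  shows "f - g \<in> polys_in V"
  using assms keys_diff[of f g] by (auto simp: polys_in_def)

lemma mult_in_polys_in:
  assumes "f \<in> polys_in V" "g \<in> polys_in V"
  shows "f * g \<in> polys_in V"
  unfolding polys_in_def
proof (intro CollectI ballI)
  fix m assume "m \<in> Poly_Mapping.keys (f * g)"
  then obtain a b where "m = a + b" "a \<in> Poly_Mapping.keys f" "b \<in> Poly_Mapping.keys g"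
    using keys_mult[of f g] by auto
  then show "Poly_Mapping.keys m \<subseteq> V"
    using assms Poly_Mapping.keys_add[of a b] unfolding polys_in_def by blast
qed

lemma sos_in_power2: "g \<in> polys_in V \<Longrightarrow> sos_in V (g\<^sup>2)"
  unfolding sos_in_def by (intro exI[of _ "[g]"]) simp

lemma sos_in_0: "sos_in V 0"
  unfolding sos_in_def by (intro exI[of _ "[]"]) simp

lemma sos_in_add:
  assumes "sos_in V f" "sos_in V g"
  shows "sos_in V (f + g)"
proof -
  obtain fs gs where "set fs \<subseteq> polys_in V" "f = (\<Sum>h\<leftarrow>fs. h\<^sup>2)"
    "set gs \<subseteq> polys_in V" "g = (\<Sum>h\<leftarrow>gs. h\<^sup>2)"
    using assms unfolding sos_in_def by blast
  then show ?thesis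
    unfolding sos_in_def by (intro exI[of _ "fs @ gs"]) simp
qed

lemma sos_in_sum:
  assumes "\<And>i. i \<in> A \<Longrightarrow> sos_in V (f i)"
  shows "sos_in V (\<Sum>i\<in>A. f i)"
  \<comment> \<open>For infinite \<open>A\<close> the sum has the default value 0, covered by
    \<open>sos_in_0\<close>.\<close>
  using assms by (induction A rule: infinite_finite_induct) (auto intro: sos_in_0 sos_in_add)

text \<open>The factor \<open>sqrt c\<close> is absorbed into each squared polynomial. With
  \<open>c = 1 / 2\<close> this undoes the doubling in \<open>BW_cyclic_hankel\<close>.\<close>

lemma sos_in_scale:
  assumes "sos_in V f" "c \<ge> 0"
  shows "sos_in V (Poly_Mapping.single 0 c * f)"
proof -
  obtain gs where gs: "set gs \<subseteq> polys_in V" "f = (\<Sum>g\<leftarrow>gs. g\<^sup>2)"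
    using assms(1) unfolding sos_in_def by blast
  let ?s = "Poly_Mapping.single 0 (sqrt c) :: 'a rpoly"
  have "?s\<^sup>2 = Poly_Mapping.single 0 c"
    using assms(2) by (simp add: power2_eq_square mult_single)
  then have "Poly_Mapping.single 0 c * f = (\<Sum>g\<leftarrow>map ((*) ?s) gs. g\<^sup>2)"
    by (simp add: gs(2) o_def power_mult_distrib sum_list_const_mult)
  moreover have "set (map ((*) ?s) gs) \<subseteq> polys_in V"
    using gs(1) by (auto intro: mult_in_polys_in single_0_in_polys_in)
  ultimately show ?thesis
    unfolding sos_in_def by blast
qed

theorem theorem2:
  fixes n :: nat and P Q :: "bw_var rpoly mat"
  assumes "n \<ge> 1"
    and "P = cyclic_hankel n (\<lambda>k. Var (PVar k))"
    and "Q = cyclic_hankel n (\<lambda>k. Var (QVar k))"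
  shows "sos_in (bw_vars n) (BW P Q)"
proof -
  define x where "x = hankel_minor n (\<lambda>k. Var (PVar k)) (\<lambda>k. Var (QVar k))"
  have n: "n > 0" using assms(1) by simp
  have "x i j k \<in> polys_in (bw_vars n)" for i j k
    unfolding x_def hankel_minor_def using n
    \<comment> \<open>The variable indices have the form \<open>a mod n + 1\<close>, which lies in
      \<open>{1..n}\<close> because \<open>n > 0\<close>.\<close>
    by (intro diff_in_polys_in mult_in_polys_in Var_in_polys_in)
      (auto simp: bw_vars_def Suc_le_eq)
  then have "sos_in (bw_vars n) (\<Sum>i<n. \<Sum>j<n. \<Sum>k<n. \<Sum>l<n. (x i j k - x i j l)\<^sup>2)"
    by (intro sos_in_sum sos_in_power2 diff_in_polys_in)
  then have "sos_in (bw_vars n) (2 * BW P Q)"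
    unfolding x_def assms(2,3) BW_cyclic_hankel[OF n] .
  then have "sos_in (bw_vars n) (Poly_Mapping.single 0 (1 / 2) * (2 * BW P Q))"
    by (rule sos_in_scale) simp
  \<comment> \<open>The numeral 2 is the constant polynomial \<open>single 0 2\<close>, so the
    product is computed on coefficients.\<close>
  moreover have "Poly_Mapping.single 0 (1 / 2) * 2 = (1 :: bw_var rpoly)"
    by (simp add: mult_single flip: single_numeral)
  ultimately show ?thesis
    by (simp flip: mult.assoc)
qed

end
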